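(* There exists an absolute constant $C>0$ such that for every integer $m\ge 2$, every $0<\varepsilon\le 1/2$ and every $n$, there is a non-adaptive one-sided $\varepsilon$-test for $\mathcal{S}_m$ over $\{0,1\}^n$ in the Huge Object model that makes at most $C\,\varepsilon^{-1}\log(\varepsilon^{-1})\cdot m\log m$ queries.
   Context: Huge Object model: the input is an unknown distribution $P$ over $\{0,1\}^n$. An algorithm may draw independent samples from $P$ and may only query individual bits of drawn samples; its query complexity is the total number of bit queries. It is non-adaptive if all sampling and querying decisions are fixed in advance (possibly randomly) before any answer is received. $d_H(u,v)=\frac1n|\{i:u_i\ne v_i\}|$; for distributions $P,Q$ over $\{0,1\}^n$, $d(P,Q)=\min_T\mathbb{E}_{(u,v)\sim T}[d_H(u,v)]$ over couplings $T$ of $P,Q$. $\mathcal{S}_m$ is the set of distributions supported on at most $m$ elements; $P$ is $\varepsilon$-far from $\mathcal{S}_m$ if $\min_{Q\in\mathcal{S}_m}d(P,Q)>\varepsilon$. A one-sided $\varepsilon$-test for $\mathcal{S}_m$ accepts every $P\in\mathcal{S}_m$ with probability $1$ and rejects every $P$ that is $\varepsilon$-far from $\mathcal{S}_m$ with probability greater than $2/3$. *)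

theory Defs
  imports "HOL-Probability.Probability"
begin

text \<open>An element of \<open>{0,1}\<^sup>n\<close> is a boolean list of length \<open>n\<close>.\<close>

definition cube :: "nat \<Rightarrow> bool list set" where
  "cube n = {x. length x = n}"

definition distributions :: "nat \<Rightarrow> bool list pmf set" where
  "distributions n = {P. set_pmf P \<subseteq> cube n}"

definition hamming :: "nat \<Rightarrow> bool list \<Rightarrow> bool list \<Rightarrow> real" where
  "hamming n u v = real (card {i. i < n \<and> u ! i \<noteq> v ! i}) / real n"

definition couplings :: "'a pmf \<Rightarrow> 'a pmf \<Rightarrow> ('a \<times> 'a) pmf set" where
  "couplings P Q = {T. map_pmf fst T = P \<and> map_pmf snd T = Q}"

text \<open>Both minima below, over couplings and over \<open>S\<^sub>m\<close>, are written as infima of sets of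
  nonnegative reals. They are attained, because the cube is finite and so a continuous function is
  being minimised over a compact set.\<close>

definition emd :: "nat \<Rightarrow> bool list pmf \<Rightarrow> bool list pmf \<Rightarrow> real" where
  "emd n P Q = (INF T\<in>couplings P Q. measure_pmf.expectation T (\<lambda>(u, v). hamming n u v))"

definition supp_at_most :: "nat \<Rightarrow> nat \<Rightarrow> bool list pmf set" where
  "supp_at_most n m = {P \<in> distributions n. card (set_pmf P) \<le> m}"

definition far_from_supp :: "nat \<Rightarrow> nat \<Rightarrow> real \<Rightarrow> bool list pmf \<Rightarrow> bool" where
  "far_from_supp n m \<epsilon> P \<longleftrightarrow> (INF Q\<in>supp_at_most n m. emd n P Q) > \<epsilon>"

text \<open>A plan \<open>(s, J)\<close> draws \<open>s\<close> samples, and \<open>(i, j) \<in> J\<close> means that bit \<open>j\<close> of sample \<open>i\<close> is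
  queried. A non-adaptive algorithm chooses its plan at random before seeing any answer; its verdict
  (\<open>True\<close> for acceptance) is then a possibly randomised function of the plan and of the answers. The
  answers are a partial map with domain \<open>J\<close>, so that the verdict has no access to unqueried bits.\<close>

type_synonym plan = "nat \<times> (nat \<times> nat) set"

type_synonym answers = "nat \<times> nat \<Rightarrow> bool option"

datatype nonadaptive_alg =
  Nonadaptive_Alg (plan_dist: "plan pmf") (verdict: "plan \<Rightarrow> answers \<Rightarrow> bool pmf")

definition valid_alg :: "nat \<Rightarrow> nonadaptive_alg \<Rightarrow> bool" where
  "valid_alg n A \<longleftrightarrow> (\<forall>(s, J) \<in> set_pmf (plan_dist A). J \<subseteq> {..<s} \<times> {..<n})"

definition answers_of :: "(nat \<times> nat) set \<Rightarrow> bool list list \<Rightarrow> answers" where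
  "answers_of J xs = (\<lambda>(i, j). if (i, j) \<in> J then Some (xs ! i ! j) else None)"

text \<open>The samples are independent of each other and of the plan.\<close>

definition run :: "nonadaptive_alg \<Rightarrow> bool list pmf \<Rightarrow> bool pmf" where
  "run A P =
    bind_pmf (plan_dist A) (\<lambda>(s, J).
      bind_pmf (replicate_pmf s P) (\<lambda>xs. verdict A (s, J) (answers_of J xs)))"

text \<open>The query bound holds in the worst case over the internal randomness.\<close>

definition queries_at_most :: "nonadaptive_alg \<Rightarrow> real \<Rightarrow> bool" where
  "queries_at_most A q \<longleftrightarrow> (\<forall>(s, J) \<in> set_pmf (plan_dist A). real (card J) \<le> q)"

definition one_sided_test :: "nat \<Rightarrow> nat \<Rightarrow> real \<Rightarrow> nonadaptive_alg \<Rightarrow> bool" where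
  "one_sided_test n m \<epsilon> A \<longleftrightarrow>
    (\<forall>P \<in> supp_at_most n m. pmf (run A P) True = 1) \<and>
    (\<forall>P \<in> distributions n. far_from_supp n m \<epsilon> P \<longrightarrow> pmf (run A P) False > 2 / 3)"

end

theory Submission
  imports Defs
begin

text \<open>Fix increasing thresholds \<open>t\<^sub>0 \<le> t\<^sub>1 \<le> \<dots>\<close> and query sample \<open>i\<close> on the first \<open>q\<^sub>i \<approx> 6 ln m / t\<^sub>i\<close>
  entries of one random list of indices, common to all samples. The algorithm rejects iff \<open>m + 1\<close>
  samples visibly differ pairwise, so it never rejects a distribution in \<open>S\<^sub>m\<close>.

  For the analysis, pick sample \<open>i\<close> if it is at distance at least \<open>t\<^sub>i\<close> from all earlier picks. If
  \<open>P\<close> is far from \<open>S\<^sub>m\<close>, then as long as there are at most \<open>m\<close> picks the conditional pick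
  probabilities add up to a large multiple of \<open>m\<close>; an exponential supermartingale shows that this is
  unlikely to leave only \<open>m\<close> picks. Picks are determined by the samples alone, hence independent of
  the index list. Since \<open>q\<close> is decreasing, an earlier pick is queried wherever a later pick \<open>i\<close> is,
  and \<open>q\<^sub>i\<close> common queries separate the two except with probability \<open>m\<^bsup>-6\<^esup>\<close>, so a union bound
  applies.\<close>

section \<open>Greedy picks and an exponential supermartingale\<close>

fun picks :: "(nat \<Rightarrow> real) \<Rightarrow> ('a \<Rightarrow> 'a \<Rightarrow> real) \<Rightarrow> 'a list \<Rightarrow> nat \<Rightarrow> nat set" where
  "picks t d xs 0 = {}"
| "picks t d xs (Suc i) =
     (if \<forall>j\<in>picks t d xs i. t i \<le> d (xs ! i) (xs ! j)
      then insert i (picks t d xs i) else picks t d xs i)"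

lemma picks_subset: "picks t d xs i \<subseteq> {..<i}"
  by (induction i) (auto simp: less_Suc_eq)

lemma finite_picks: "finite (picks t d xs i)"
  by (rule finite_subset[OF picks_subset]) simp

lemma picks_mono: "i \<le> k \<Longrightarrow> picks t d xs i \<subseteq> picks t d xs k"
  by (induction rule: dec_induct) auto

lemma picks_append: "i \<le> length xs \<Longrightarrow> picks t d (xs @ ys) i = picks t d xs i"
proof (induction i)
  case (Suc i)
  have "(xs @ ys) ! j = xs ! j" if "j \<in> insert i (picks t d xs i)" for j
    using that picks_subset[of t d xs i] Suc.prems by (auto simp: nth_append)
  with Suc show ?case
    by (simp cong: ball_cong)
qed simp

lemma picks_apart:
  assumes "i \<in> picks t d xs s" "j \<in> picks t d xs s" "j < i"
  shows "t i \<le> d (xs ! i) (xs ! j)"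
  using assms
proof (induction s)
  case (Suc s)
  have "i \<le> s" "j < s"
    using Suc.prems picks_subset[of t d xs "Suc s"] by auto
  with Suc show ?case
    by (cases "i = s") (auto split: if_splits)
qed simp

text \<open>The probability that sample \<open>i\<close> becomes a pick, conditional on the earlier
  samples: only the first \<open>i\<close> entries of \<open>xs\<close> matter.\<close>

definition pick_prob ::
    "(nat \<Rightarrow> real) \<Rightarrow> ('a \<Rightarrow> 'a \<Rightarrow> real) \<Rightarrow> 'a pmf \<Rightarrow> 'a list \<Rightarrow> nat \<Rightarrow> real" where
  "pick_prob t d P xs i =
     measure_pmf.prob P {u. \<forall>j\<in>picks t d xs i. t i \<le> d u (xs ! j)}"

lemma pick_prob_append:
  assumes "i \<le> length xs"
  shows "pick_prob t d P (xs @ ys) i = pick_prob t d P xs i"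
proof -
  have "(xs @ ys) ! j = xs ! j" if "j \<in> picks t d xs i" for j
    using that picks_subset[of t d xs i] assms by (auto simp: nth_append)
  then show ?thesis
    by (simp add: pick_prob_def picks_append[OF assms] cong: ball_cong)
qed

text \<open>A supermartingale in \<open>k\<close>: a pick of conditional probability p halves the
  weight, an expected factor 1 - p/2 <= exp (-p/2), for which the factor exp (p/2)
  compensates.\<close>

definition picks_weight ::
    "(nat \<Rightarrow> real) \<Rightarrow> ('a \<Rightarrow> 'a \<Rightarrow> real) \<Rightarrow> 'a pmf \<Rightarrow> nat \<Rightarrow> 'a list \<Rightarrow> real" where
  "picks_weight t d P k xs =
     (1 / 2) ^ card (picks t d xs k) * exp ((\<Sum>i<k. pick_prob t d P xs i) / 2)"

lemma picks_weight_nonneg: "0 \<le> picks_weight t d P k xs"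
  by (simp add: picks_weight_def)

lemma picks_weight_step:
  assumes "length xs = k"
  shows "(\<integral>\<^sup>+x. ennreal (picks_weight t d P (Suc k) (xs @ [x])) \<partial>measure_pmf P)
    \<le> ennreal (picks_weight t d P k xs)"
proof -
  define N where "N = {u. \<forall>j\<in>picks t d xs k. t k \<le> d u (xs ! j)}"
  define p where "p = pick_prob t d P xs k"
  define w where "w = picks_weight t d P k xs"
  have p: "p = measure_pmf.prob P N"
    by (simp add: p_def N_def pick_prob_def)
  have nth: "(xs @ [x]) ! j = xs ! j" if "j \<in> picks t d xs k" for x j
    using that picks_subset[of t d xs k] assms by (auto simp: nth_append)
  have card: "card (picks t d (xs @ [x]) (Suc k)) =
      card (picks t d xs k) + (if x \<in> N then 1 else 0)" for x
  proof -
    have "k \<notin> picks t d xs k" using picks_subset[of t d xs k] by auto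
    moreover have "picks t d (xs @ [x]) (Suc k) =
        (if x \<in> N then insert k (picks t d xs k) else picks t d xs k)"
    proof -
      have "picks t d (xs @ [x]) k = picks t d xs k" "(xs @ [x]) ! k = x"
        using assms by (simp_all add: picks_append flip: assms)
      then show ?thesis by (simp add: nth N_def cong: ball_cong)
    qed
    ultimately show ?thesis by (simp add: finite_picks)
  qed
  have sum: "(\<Sum>i<Suc k. pick_prob t d P (xs @ [x]) i) = (\<Sum>i<k. pick_prob t d P xs i) + p" for x
    using assms by (simp add: pick_prob_append p_def)
  have eq: "picks_weight t d P (Suc k) (xs @ [x]) = w * exp (p / 2) * (1 - indicator N x / 2)" for x
    unfolding picks_weight_def sum card w_def
    by (simp add: add_divide_distrib exp_add indicator_def)
  have w0: "0 \<le> w" by (simp add: w_def picks_weight_nonneg)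
  have half: "integrable (measure_pmf P) (\<lambda>x. indicator N x / 2 :: real)"
    by (intro measure_pmf.integrable_const_bound[where B = 1]) (auto simp: indicator_def)
  have int: "integrable (measure_pmf P) (\<lambda>x. w * exp (p / 2) * (1 - indicator N x / 2))"
    by (intro measure_pmf.integrable_const_bound[where B = "w * exp (p / 2)"])
       (auto simp: w0 indicator_def abs_mult)
  have "(\<integral>\<^sup>+x. ennreal (picks_weight t d P (Suc k) (xs @ [x])) \<partial>measure_pmf P)
     = ennreal (measure_pmf.expectation P (\<lambda>x. w * exp (p / 2) * (1 - indicator N x / 2)))"
    unfolding eq using int by (rule nn_integral_eq_integral) (auto simp: w0 indicator_def)
  also have "measure_pmf.expectation P (\<lambda>x. w * exp (p / 2) * (1 - indicator N x / 2))
      = w * exp (p / 2) * (1 - p / 2)"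
    using half by (simp add: p)
  also have "\<dots> \<le> w"
  proof -
    have "1 - p / 2 \<le> exp (- (p / 2))" using exp_ge_add_one_self[of "- (p / 2)"] by simp
    then have "exp (p / 2) * (1 - p / 2) \<le> exp (p / 2) * exp (- (p / 2))"
      by (intro mult_left_mono) auto
    also have "\<dots> = 1" by (simp flip: exp_add)
    finally show ?thesis using mult_left_mono[OF _ w0, of "exp (p / 2) * (1 - p / 2)" 1] by (simp add: mult.assoc)
  qed
  finally show ?thesis by (simp add: w_def ennreal_leI)
qed

text \<open>\<open>replicate_pmf\<close> recurses at the head of the list; splitting off the last
  sample instead allows conditioning on the earlier ones.\<close>

lemma replicate_pmf_Suc_snoc:
  "replicate_pmf (Suc k) P = bind_pmf (replicate_pmf k P) (\<lambda>xs. map_pmf (\<lambda>x. xs @ [x]) P)"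
  using replicate_pmf_distrib[of k 1 P]
  by (simp add: map_pmf_def bind_assoc_pmf bind_return_pmf)

lemma picks_weight_integral:
  "(\<integral>\<^sup>+xs. ennreal (picks_weight t d P k xs) \<partial>replicate_pmf k P) \<le> 1"
proof (induction k)
  case (Suc k)
  have "(\<integral>\<^sup>+xs. ennreal (picks_weight t d P (Suc k) xs) \<partial>replicate_pmf (Suc k) P) =
      (\<integral>\<^sup>+xs. (\<integral>\<^sup>+x. ennreal (picks_weight t d P (Suc k) (xs @ [x])) \<partial>P) \<partial>replicate_pmf k P)"
    by (simp only: replicate_pmf_Suc_snoc nn_integral_bind_pmf nn_integral_map_pmf)
  also have "\<dots> \<le> (\<integral>\<^sup>+xs. ennreal (picks_weight t d P k xs) \<partial>replicate_pmf k P)"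
    by (intro nn_integral_mono_AE AE_pmfI picks_weight_step) (simp add: set_replicate_pmf)
  finally show ?case using Suc.IH by simp
qed (simp add: picks_weight_def)

text \<open>Markov's inequality: on this event \<open>picks_weight\<close> is at least 2^(-m) exp
  (a/2), while its mean is at most 1.\<close>

lemma prob_few_picks:
  "measure_pmf.prob (replicate_pmf k P)
     {xs. card (picks t d xs k) \<le> m \<and> a \<le> (\<Sum>i<k. pick_prob t d P xs i)}
   \<le> 2 ^ m * exp (- (a / 2))" (is "measure_pmf.prob ?R ?B \<le> _")
proof -
  define c where "c = (1 / 2) ^ m * exp (a / 2)"
  have c: "c > 0" by (simp add: c_def)
  have w: "c \<le> picks_weight t d P k xs" if "xs \<in> ?B" for xs
    unfolding c_def picks_weight_def using that by (intro mult_mono power_decreasing) auto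
  have "ennreal (c * measure_pmf.prob ?R ?B) = ennreal c * emeasure ?R ?B"
    using c by (simp add: measure_pmf.emeasure_eq_measure ennreal_mult)
  also have "\<dots> = (\<integral>\<^sup>+xs. ennreal c * indicator ?B xs \<partial>?R)"
    by (subst nn_integral_cmult) simp_all
  also have "\<dots> \<le> (\<integral>\<^sup>+xs. ennreal (picks_weight t d P k xs) \<partial>?R)"
    using w by (intro nn_integral_mono) (auto simp: indicator_def intro: ennreal_leI)
  also have "\<dots> \<le> 1" by (rule picks_weight_integral)
  finally have "c * measure_pmf.prob ?R ?B \<le> 1" by simp
  then have "measure_pmf.prob ?R ?B \<le> 1 / c" using c by (simp add: field_simps)
  also have "1 / c = 2 ^ m * exp (- (a / 2))"
    by (simp add: c_def exp_minus field_simps)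
  finally show ?thesis .
qed

section \<open>Separating strings by random indices\<close>

text \<open>Prefixes of a longer list are considered because the samples read different numbers of
  entries of one common list.\<close>

lemma prob_replicate_pmf_prefix:
  assumes "q \<le> k"
  shows "measure_pmf.prob (replicate_pmf k D) {js. \<forall>r<q. js ! r \<in> A} =
    measure_pmf.prob D A ^ q"
  using assms
proof (induction k arbitrary: q)
  case (Suc k)
  show ?case
  proof (cases q)
    case q: (Suc q')
    let ?B = "{js. \<forall>r<q'. js ! r \<in> A}"
    have "replicate_pmf (Suc k) D = bind_pmf D (\<lambda>x. map_pmf ((#) x) (replicate_pmf k D))"
      by (simp add: map_pmf_def)
    moreover have "(#) x -` {js. \<forall>r<q. js ! r \<in> A} = (if x \<in> A then ?B else {})" for x
      by (auto simp: q All_less_Suc2)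
    ultimately have "emeasure (replicate_pmf (Suc k) D) {js. \<forall>r<q. js ! r \<in> A} =
        (\<integral>\<^sup>+x. emeasure (replicate_pmf k D) (if x \<in> A then ?B else {}) \<partial>D)"
      by simp
    also have "\<dots> = (\<integral>\<^sup>+x. emeasure (replicate_pmf k D) ?B * indicator A x \<partial>D)"
      by (intro nn_integral_cong) (simp add: indicator_def)
    also have "\<dots> = emeasure (replicate_pmf k D) ?B * emeasure D A"
      by (subst nn_integral_cmult) simp_all
    finally show ?thesis
      using Suc.IH[of q'] Suc.prems
      by (simp add: q measure_pmf.emeasure_eq_measure mult.commute flip: ennreal_mult)
  qed simp
qed simp

lemma hamming_nonneg: "0 \<le> hamming n u v"
  by (simp add: hamming_def)

lemma hamming_le_1: "hamming n u v \<le> 1"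
proof -
  have "card {i. i < n \<and> u ! i \<noteq> v ! i} \<le> card {..<n}"
    by (intro card_mono) auto
  then show ?thesis by (cases "n = 0") (simp_all add: hamming_def)
qed

lemma hamming_eq_prob:
  assumes "0 < n"
  shows "measure_pmf.prob (pmf_of_set {..<n}) {j. u ! j = v ! j} = 1 - hamming n u v"
proof -
  define N where "N = {i. i < n \<and> u ! i \<noteq> v ! i}"
  have N: "N \<subseteq> {..<n}" "finite N" by (auto simp: N_def)
  have "card N \<le> n" using card_mono[OF _ N(1)] by simp
  have "measure_pmf.prob (pmf_of_set {..<n}) {j. u ! j = v ! j}
      = card ({..<n} \<inter> {j. u ! j = v ! j}) / n"
    using assms by (subst measure_pmf_of_set) auto
  also have "{..<n} \<inter> {j. u ! j = v ! j} = {..<n} - N" by (auto simp: N_def)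
  also have "real (card ({..<n} - N)) = real n - real (card N)"
    using N \<open>card N \<le> n\<close> by (simp add: card_Diff_subset of_nat_diff)
  finally show ?thesis
    using assms by (simp add: hamming_def N_def diff_divide_distrib)
qed

text \<open>A random index misses the difference with probability 1 - h, where h is the distance.
  Then (1 - h)^q <= exp (-q h), and q h >= q t >= c.\<close>

lemma prob_agree_on_sample:
  assumes "0 < n" "q \<le> k" "0 < t" "t \<le> hamming n u v" "c / t \<le> q"
  shows "measure_pmf.prob (replicate_pmf k (pmf_of_set {..<n})) {js. \<forall>r<q. u ! (js ! r) = v ! (js ! r)}
    \<le> exp (- c)"
proof -
  let ?h = "hamming n u v"
  have "measure_pmf.prob (replicate_pmf k (pmf_of_set {..<n})) {js. \<forall>r<q. u ! (js ! r) = v ! (js ! r)}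
      = (1 - ?h) ^ q"
    using prob_replicate_pmf_prefix[OF assms(2), of "pmf_of_set {..<n}" "{j. u ! j = v ! j}"]
      hamming_eq_prob[OF assms(1)] by simp
  also have "\<dots> \<le> exp (- ?h) ^ q"
    using exp_ge_add_one_self[of "- ?h"] hamming_le_1[of n u v] by (intro power_mono) auto
  also have "\<dots> = exp (- (real q * ?h))" by (simp flip: exp_of_nat_mult)
  also have "c \<le> real q * t" using assms by (simp add: field_simps)
  then have "c \<le> real q * ?h" using assms by (meson mult_left_mono of_nat_0_le_iff order_trans)
  then have "exp (- (real q * ?h)) \<le> exp (- c)" by simp
  finally show ?thesis .
qed

text \<open>Union bound over pairs. The later index \<open>i\<close> sets the number of comparisons,
  because the pair is only known to be at distance at least \<open>t i\<close>.\<close>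

lemma prob_some_pair_agrees:
  assumes "0 < n" "finite S"
    and t: "\<And>i. i \<in> S \<Longrightarrow> 0 < t i"
    and apart: "\<And>i j. i \<in> S \<Longrightarrow> j \<in> S \<Longrightarrow> j < i \<Longrightarrow> t i \<le> hamming n (x i) (x j)"
    and q: "\<And>i. i \<in> S \<Longrightarrow> q i \<le> k" "\<And>i. i \<in> S \<Longrightarrow> c / t i \<le> q i"
  shows "measure_pmf.prob (replicate_pmf k (pmf_of_set {..<n}))
      {js. \<exists>i\<in>S. \<exists>j\<in>S. j < i \<and> (\<forall>r<q i. x i ! (js ! r) = x j ! (js ! r))}
    \<le> real (card S) ^ 2 * exp (- c)"
proof -
  let ?D = "replicate_pmf k (pmf_of_set {..<n})"
  let ?I = "{(i, j). i \<in> S \<and> j \<in> S \<and> j < i}"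
  let ?B = "\<lambda>(i, j). {js. \<forall>r<q i. x i ! (js ! r) = x j ! (js ! r)}"
  have I: "?I \<subseteq> S \<times> S" by auto
  then have fin: "finite ?I" by (rule finite_subset) (simp add: assms(2))
  have "card ?I \<le> card (S \<times> S)" using I assms(2) by (intro card_mono) auto
  then have card: "real (card ?I) \<le> real (card S) ^ 2"
    by (simp add: card_cartesian_product power2_eq_square flip: of_nat_mult)
  have "{js. \<exists>i\<in>S. \<exists>j\<in>S. j < i \<and> (\<forall>r<q i. x i ! (js ! r) = x j ! (js ! r))} = \<Union> (?B ` ?I)"
    by auto
  also have "measure_pmf.prob ?D (\<Union> (?B ` ?I)) \<le> (\<Sum>p\<in>?I. measure_pmf.prob ?D (?B p))"
    using fin by (rule measure_pmf.finite_measure_subadditive_finite) simp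
  also have "\<dots> \<le> (\<Sum>p\<in>?I. exp (- c))"
  proof (rule sum_mono)
    fix p assume "p \<in> ?I"
    then obtain i j where p: "p = (i, j)" "i \<in> S" "j \<in> S" "j < i" by auto
    then show "measure_pmf.prob ?D (?B p) \<le> exp (- c)"
      using assms(1) t apart q
        prob_agree_on_sample[where t = "t i" and u = "x i" and v = "x j" and q = "q i" and k = k and c = c]
      by simp
  qed
  also have "\<dots> \<le> real (card S) ^ 2 * exp (- c)"
    using card by (simp add: mult_right_mono)
  finally show ?thesis .
qed

section \<open>Earth mover's distance to small supports\<close>

lemma finite_cube: "finite (cube n)"
  using finite_lists_length_eq[of "UNIV :: bool set" n] by (simp add: cube_def)

lemma finite_set_pmf_distributions: "P \<in> distributions n \<Longrightarrow> finite (set_pmf P)"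
  using finite_cube finite_subset by (auto simp: distributions_def)

lemma emd_nonneg: "0 \<le> emd n P Q"
proof -
  \<comment> \<open>The independent coupling shows that the infimum ranges over a nonempty
    set.\<close>
  have "pair_pmf P Q \<in> couplings P Q"
    by (simp add: couplings_def map_fst_pair_pmf map_snd_pair_pmf)
  then show ?thesis unfolding emd_def
    by (intro cINF_greatest) (auto intro!: Bochner_Integration.integral_nonneg simp: hamming_nonneg)
qed

text \<open>The coupling that moves each \<open>u\<close> to \<open>f u\<close> has exactly this
  cost.\<close>

lemma emd_le_expectation:
  "emd n P (map_pmf f P) \<le> measure_pmf.expectation P (\<lambda>u. hamming n u (f u))"
proof -
  let ?T = "map_pmf (\<lambda>u. (u, f u)) P"
  have "?T \<in> couplings P (map_pmf f P)"
    by (simp add: couplings_def pmf.map_comp o_def)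
  then have "emd n P (map_pmf f P) \<le> measure_pmf.expectation ?T (\<lambda>(u, v). hamming n u v)"
    unfolding emd_def
    by (intro cINF_lower bdd_belowI2[where m = 0]) (auto intro!: Bochner_Integration.integral_nonneg simp: hamming_nonneg)
  then show ?thesis by simp
qed

text \<open>Moving every string to a nearest point of \<open>V\<close> produces a member of
  \<open>supp_at_most n m\<close>, at a cost equal to the mean distance to \<open>V\<close>.\<close>

lemma far_imp_expectation_Min:
  assumes "far_from_supp n m \<epsilon> P" and V: "V \<subseteq> cube n" "V \<noteq> {}" "card V \<le> m"
  shows "\<epsilon> < measure_pmf.expectation P (\<lambda>u. Min (hamming n u ` V))"
proof -
  have fin: "finite V" using V(1) finite_cube by (rule finite_subset)
  have "\<forall>u. \<exists>v\<in>V. hamming n u v = Min (hamming n u ` V)"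
  proof
    fix u
    have "Min (hamming n u ` V) \<in> hamming n u ` V" using fin V(2) by (intro Min_in) auto
    then show "\<exists>v\<in>V. hamming n u v = Min (hamming n u ` V)" by auto
  qed
  then obtain f where f: "\<And>u. f u \<in> V" "\<And>u. hamming n u (f u) = Min (hamming n u ` V)"
    by metis
  let ?Q = "map_pmf f P"
  have sub: "set_pmf ?Q \<subseteq> V" using f(1) by auto
  then have "card (set_pmf ?Q) \<le> m" using card_mono[OF fin sub] V(3) by simp
  then have "?Q \<in> supp_at_most n m"
    using sub V(1) by (auto simp: supp_at_most_def distributions_def)
  then have "(INF Q\<in>supp_at_most n m. emd n P Q) \<le> emd n P ?Q"
    by (intro cINF_lower bdd_belowI2[where m = 0]) (auto simp: emd_nonneg)
  also have "\<dots> \<le> measure_pmf.expectation P (\<lambda>u. Min (hamming n u ` V))"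
    using emd_le_expectation[of n P f] by (simp add: f(2))
  finally show ?thesis using assms(1) by (simp add: far_from_supp_def)
qed

section \<open>Thresholds, and pick probabilities under farness\<close>

text \<open>The thresholds climb linearly from just above \<open>\<epsilon> / 2\<close> to about 1. A sample at distance \<open>x\<close> from the
  picks meets about \<open>2 * M * x / \<epsilon> - M\<close> of them, which averages to more than \<open>M\<close> when the mean
  distance exceeds \<open>\<epsilon>\<close>; starting at \<open>\<epsilon> / 2\<close> keeps the harmonic sum of the query costs at
  \<open>ln (2 / \<epsilon>)\<close>, free of an extra \<open>ln M\<close>.\<close>

definition threshold :: "nat \<Rightarrow> real \<Rightarrow> nat \<Rightarrow> real" where
  "threshold M \<epsilon> i = (real M + 1 + real i) * \<epsilon> / (2 * real M)"

text \<open>For positive \<open>M\<close> and \<open>\<epsilon>\<close>, this counts exactly the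
  indices whose threshold is at most 1, the largest possible distance.\<close>

definition num_samples :: "nat \<Rightarrow> real \<Rightarrow> nat" where
  "num_samples M \<epsilon> = nat \<lfloor>2 * real M / \<epsilon>\<rfloor> - M"

lemma threshold_pos: "0 < M \<Longrightarrow> 0 < \<epsilon> \<Longrightarrow> 0 < threshold M \<epsilon> i"
  by (simp add: threshold_def)

lemma threshold_mono: "0 < \<epsilon> \<Longrightarrow> i \<le> j \<Longrightarrow> threshold M \<epsilon> i \<le> threshold M \<epsilon> j"
  by (auto simp: threshold_def intro!: divide_right_mono mult_right_mono)

lemma num_samples_bounds:
  assumes "0 < M" "0 < \<epsilon>" "\<epsilon> \<le> 1 / 2"
  shows "0 < num_samples M \<epsilon>" "real M + real (num_samples M \<epsilon>) \<le> 2 * real M / \<epsilon>"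
proof -
  \<comment> \<open>As \<open>\<epsilon>\<close> is at most 1/2, the subtraction of \<open>M\<close>
    in \<open>num_samples\<close> does not truncate.\<close>
  have "real M * 4 \<le> 2 * real M / \<epsilon>" using assms by (simp add: field_simps)
  then have "4 * M \<le> nat \<lfloor>2 * real M / \<epsilon>\<rfloor>" by linarith
  moreover have "real (nat \<lfloor>2 * real M / \<epsilon>\<rfloor>) \<le> 2 * real M / \<epsilon>"
    using assms by (intro of_nat_floor) auto
  ultimately show "0 < num_samples M \<epsilon>" "real M + real (num_samples M \<epsilon>) \<le> 2 * real M / \<epsilon>"
    using assms(1) by (auto simp: num_samples_def of_nat_diff)
qed

text \<open>With y = 2 M x / \<epsilon>, threshold \<open>i\<close> is at most \<open>x\<close> iff
  M + 1 + i <= y. The final 1 pays for rounding y down, and x <= 1 keeps all these \<open>i\<close>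
  below \<open>num_samples\<close>.\<close>

lemma card_threshold_le:
  assumes "0 < M" "0 < \<epsilon>" "0 \<le> x" "x \<le> 1"
  shows "2 * real M * x / \<epsilon> - real M - 1 \<le> real (card {i. i < num_samples M \<epsilon> \<and> threshold M \<epsilon> i \<le> x})"
proof -
  define y where "y = 2 * real M * x / \<epsilon>"
  have y0: "0 \<le> y" using assms by (simp add: y_def)
  have "y \<le> 2 * real M / \<epsilon>" using assms by (simp add: y_def divide_right_mono)
  then have le: "nat \<lfloor>y\<rfloor> \<le> nat \<lfloor>2 * real M / \<epsilon>\<rfloor>" by (intro nat_mono floor_mono)
  have "{..<nat \<lfloor>y\<rfloor> - M} \<subseteq> {i. i < num_samples M \<epsilon> \<and> threshold M \<epsilon> i \<le> x}"
  proof
    fix i assume "i \<in> {..<nat \<lfloor>y\<rfloor> - M}"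
    then have i: "M + 1 + i \<le> nat \<lfloor>y\<rfloor>" by auto
    then have "real (M + 1 + i) \<le> y" using y0 of_nat_floor[OF y0] by linarith
    then have "threshold M \<epsilon> i \<le> x"
      using assms(1,2) by (simp add: threshold_def y_def field_simps)
    then show "i \<in> {i. i < num_samples M \<epsilon> \<and> threshold M \<epsilon> i \<le> x}"
      using i le by (auto simp: num_samples_def)
  qed
  then have "card {..<nat \<lfloor>y\<rfloor> - M} \<le> card {i. i < num_samples M \<epsilon> \<and> threshold M \<epsilon> i \<le> x}"
    by (intro card_mono) auto
  then have "nat \<lfloor>y\<rfloor> - M \<le> card {i. i < num_samples M \<epsilon> \<and> threshold M \<epsilon> i \<le> x}" by simp
  moreover have "y - 1 \<le> real (nat \<lfloor>y\<rfloor>)" using y0 by linarith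
  ultimately show ?thesis by (simp add: y_def)
qed

text \<open>The picks only bring a string closer to its nearest pick, so each pick probability is at least
  the probability computed with the final set of picks.\<close>

lemma far_imp_sum_pick_prob:
  assumes P: "P \<in> distributions n" and far: "far_from_supp n m \<epsilon> P"
    and M: "0 < M" and \<epsilon>: "0 < \<epsilon>" "\<epsilon> \<le> 1 / 2"
    and s: "s = num_samples M \<epsilon>" and t: "t = threshold M \<epsilon>"
    and xs: "xs \<in> set_pmf (replicate_pmf s P)"
    and few: "card (picks t (hamming n) xs s) \<le> m"
  shows "real M - 1 \<le> (\<Sum>i<s. pick_prob t (hamming n) P xs i)"
proof -
  define V where "V = (!) xs ` picks t (hamming n) xs s"
  define D where "D u = Min (hamming n u ` V)" for u
  have finP: "finite (set_pmf P)" using P by (rule finite_set_pmf_distributions)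
  have finV: "finite V" by (simp add: V_def finite_picks)
  have len: "length xs = s" and "set xs \<subseteq> cube n"
    using xs P by (auto simp: set_replicate_pmf distributions_def)
  then have V_cube: "V \<subseteq> cube n"
    using picks_subset[of t "hamming n" xs s] unfolding V_def by (auto dest!: subsetD)
  \<comment> \<open>The first sample is always a pick, its condition being vacuous, so a nearest
    pick exists.\<close>
  have "picks t (hamming n) xs (Suc 0) \<subseteq> picks t (hamming n) xs s"
    using num_samples_bounds(1)[OF M \<epsilon>] s by (intro picks_mono) simp
  then have V_ne: "V \<noteq> {}" by (auto simp: V_def)
  have "card V \<le> m" using card_image_le[OF finite_picks, of "(!) xs" t "hamming n" xs s] few
    by (simp add: V_def)
  then have ED: "\<epsilon> < measure_pmf.expectation P D"
    using far_imp_expectation_Min[OF far V_cube V_ne] by (simp add: D_def[abs_def])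
  have D_le: "D u \<le> hamming n u v" if "v \<in> V" for u v
    using that finV by (simp add: D_def)
  have D01: "0 \<le> D u" "D u \<le> 1" for u
  proof -
    show "0 \<le> D u" using finV V_ne by (simp add: D_def hamming_nonneg)
    obtain v where "v \<in> V" using V_ne by auto
    then show "D u \<le> 1" using D_le[of v u] hamming_le_1[of n u v] by linarith
  qed
  have int: "integrable (measure_pmf P) (f :: _ \<Rightarrow> real)" for f
    using finP by (rule integrable_measure_pmf_finite)
  \<comment> \<open>The mean of \<open>D\<close> exceeds \<open>\<epsilon>\<close>, so the first
    term on the right exceeds 2 M.\<close>
  have "real M - 1 \<le> 2 * real M * measure_pmf.expectation P D / \<epsilon> - real M - 1"
    using ED \<epsilon>(1) M by (simp add: field_simps)
  also have "\<dots> = measure_pmf.expectation P (\<lambda>u. 2 * real M * D u / \<epsilon> - real M - 1)"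
    using int[of D] by simp
  also have "\<dots> \<le> measure_pmf.expectation P (\<lambda>u. real (card {i. i < s \<and> t i \<le> D u}))"
    unfolding s t using int M \<epsilon> D01 by (intro integral_mono card_threshold_le) auto
  also have "\<dots> = measure_pmf.expectation P (\<lambda>u. \<Sum>i<s. indicator {u. t i \<le> D u} u)"
    by (simp add: indicator_def sum.If_cases Int_def)
  also have "\<dots> = (\<Sum>i<s. measure_pmf.prob P {u. t i \<le> D u})"
    using int by (subst Bochner_Integration.integral_sum) simp_all
  also have "\<dots> \<le> (\<Sum>i<s. pick_prob t (hamming n) P xs i)"
  proof (rule sum_mono)
    fix i assume "i \<in> {..<s}"
    then have "picks t (hamming n) xs i \<subseteq> picks t (hamming n) xs s" by (intro picks_mono) simp
    then have "t i \<le> hamming n u (xs ! j)" if "t i \<le> D u" "j \<in> picks t (hamming n) xs i" for u j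
      using that D_le[of "xs ! j" u] by (auto simp: V_def)
    then show "measure_pmf.prob P {u. t i \<le> D u} \<le> pick_prob t (hamming n) P xs i"
      unfolding pick_prob_def by (intro measure_pmf.finite_measure_mono) auto
  qed
  finally show ?thesis .
qed

section \<open>Query cost\<close>

lemma sum_inverse_le_ln:
  assumes "0 < M"
  shows "(\<Sum>i<s. 1 / (real M + 1 + real i)) \<le> ln ((real M + real s) / real M)"
proof (induction s)
  case (Suc s)
  define k where "k = real M + real s"
  have k: "k > 0" using assms by (simp add: k_def)
  \<comment> \<open>This gives 1/(k + 1) <= ln (k + 1) - ln k, which telescopes.\<close>
  have "ln (k / (k + 1)) \<le> k / (k + 1) - 1"
    using k by (intro ln_le_minus_one) simp
  then have "1 / (k + 1) \<le> ln ((k + 1) / M) - ln (k / M)"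
    using k assms by (simp add: ln_div field_simps)
  then show ?case using Suc.IH by (simp add: k_def add_ac)
qed (use assms in simp)

text \<open>The quotients of \<open>c\<close> by the thresholds form a harmonic sum with
  denominators M + 1 to M + s, and (M + s) / M <= 2 / \<epsilon>. Rounding up adds at most 1 for
  each of the s <= 2 M / \<epsilon> samples.\<close>

lemma sum_queries_le:
  assumes M: "0 < M" and \<epsilon>: "0 < \<epsilon>" "\<epsilon> \<le> 1 / 2" and c: "0 \<le> c"
  shows "(\<Sum>i<num_samples M \<epsilon>. real (nat \<lceil>c / threshold M \<epsilon> i\<rceil>))
    \<le> 2 * real M / \<epsilon> * (c * ln (2 / \<epsilon>) + 1)"
proof -
  let ?s = "num_samples M \<epsilon>"
  note b = num_samples_bounds[OF M \<epsilon>]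
  have "(\<Sum>i<?s. real (nat \<lceil>c / threshold M \<epsilon> i\<rceil>)) \<le> (\<Sum>i<?s. c / threshold M \<epsilon> i + 1)"
  proof (rule sum_mono)
    fix i
    have "0 \<le> c / threshold M \<epsilon> i" using c threshold_pos[OF M \<epsilon>(1), of i] by simp
    then show "real (nat \<lceil>c / threshold M \<epsilon> i\<rceil>) \<le> c / threshold M \<epsilon> i + 1" by linarith
  qed
  also have "\<dots> = 2 * real M / \<epsilon> * (c * (\<Sum>i<?s. 1 / (real M + 1 + real i))) + real ?s"
    using M \<epsilon>(1) by (simp add: threshold_def sum.distrib sum_distrib_left mult_ac)
  also have "\<dots> \<le> 2 * real M / \<epsilon> * (c * ln (2 / \<epsilon>)) + 2 * real M / \<epsilon>"
  proof -
    have "(real M + real ?s) / real M \<le> 2 / \<epsilon>" using b(2) M \<epsilon>(1) by (simp add: field_simps)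
    then have "ln ((real M + real ?s) / real M) \<le> ln (2 / \<epsilon>)"
      using M by (intro ln_mono) auto
    then have "(\<Sum>i<?s. 1 / (real M + 1 + real i)) \<le> ln (2 / \<epsilon>)"
      using sum_inverse_le_ln[OF M, of ?s] by linarith
    then show ?thesis
      using b(2) M \<epsilon>(1) c by (intro add_mono mult_left_mono) auto
  qed
  also have "\<dots> = 2 * real M / \<epsilon> * (c * ln (2 / \<epsilon>) + 1)"
    by (simp only: distrib_left mult_1_right)
  finally show ?thesis .
qed

section \<open>The clique algorithm\<close>

definition conflict :: "answers \<Rightarrow> nat \<Rightarrow> nat \<Rightarrow> bool" where
  "conflict a i j \<longleftrightarrow> (\<exists>b l. a (i, l) = Some b \<and> a (j, l) = Some (\<not> b))"

definition conflict_clique :: "nat \<Rightarrow> nat \<Rightarrow> answers \<Rightarrow> bool" where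
  "conflict_clique m s a \<longleftrightarrow>
     (\<exists>S\<subseteq>{..<s}. card S = Suc m \<and> (\<forall>i\<in>S. \<forall>j\<in>S. j < i \<longrightarrow> conflict a i j))"

definition prefix_plan :: "nat \<Rightarrow> (nat \<Rightarrow> nat) \<Rightarrow> nat list \<Rightarrow> plan" where
  "prefix_plan s q js = (s, {(i, js ! r) | i r. i < s \<and> r < q i})"

definition clique_alg :: "nat \<Rightarrow> nat \<Rightarrow> nat \<Rightarrow> (nat \<Rightarrow> nat) \<Rightarrow> nat \<Rightarrow> nonadaptive_alg" where
  "clique_alg n m s q k = Nonadaptive_Alg
     (map_pmf (prefix_plan s q) (replicate_pmf k (pmf_of_set {..<n})))
     (\<lambda>(s, J) a. return_pmf (\<not> conflict_clique m s a))"

lemma valid_clique_alg: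
  assumes "0 < n" "\<And>i. i < s \<Longrightarrow> q i \<le> k"
  shows "valid_alg n (clique_alg n m s q k)"
proof -
  have "js ! r < n" if "js \<in> set_pmf (replicate_pmf k (pmf_of_set {..<n}))" "i < s" "r < q i" for js i r
  proof -
    have "set_pmf (pmf_of_set {..<n}) = {..<n}"
      using assms(1) by (intro set_pmf_of_set) auto
    then have "set js \<subseteq> {..<n}" "r < length js"
      using that assms(2)[of i] by (auto simp: set_replicate_pmf)
    then show ?thesis using nth_mem by blast
  qed
  then show ?thesis
    by (auto simp: valid_alg_def clique_alg_def prefix_plan_def)
qed

lemma queries_clique_alg: "queries_at_most (clique_alg n m s q k) (\<Sum>i<s. real (q i))"
proof -
  have "real (card {(i, js ! r) | i r. i < s \<and> r < q i}) \<le> (\<Sum>i<s. real (q i))" for js :: "nat list"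
  proof -
    have "{(i, js ! r) | i r. i < s \<and> r < q i} = (\<lambda>(i, r). (i, js ! r)) ` (SIGMA i:{..<s}. {..<q i})"
      by auto
    also have "card \<dots> \<le> card (SIGMA i:{..<s}. {..<q i})" by (intro card_image_le) auto
    finally show ?thesis by (simp flip: of_nat_sum)
  qed
  then show ?thesis by (simp add: queries_at_most_def clique_alg_def prefix_plan_def)
qed

text \<open>Conflicting samples differ as strings, so a clique exhibits \<open>m + 1\<close>
  distinct elements of \<open>A\<close>. One-sidedness rests on this.\<close>

lemma conflict_clique_supp:
  assumes "finite A" "set xs \<subseteq> A" "length xs = s" "conflict_clique m s (answers_of J xs)"
  shows "m < card A"
proof -
  obtain S where S: "S \<subseteq> {..<s}" "card S = Suc m"
    and conf: "\<And>i j. i \<in> S \<Longrightarrow> j \<in> S \<Longrightarrow> j < i \<Longrightarrow> conflict (answers_of J xs) i j"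
    using assms(4) by (auto simp: conflict_clique_def)
  have ne: "xs ! i \<noteq> xs ! j" if "i \<in> S" "j \<in> S" "j < i" for i j
    using conf[OF that] by (auto simp: conflict_def answers_of_def split: if_splits)
  have "inj_on ((!) xs) S"
    using ne by (intro inj_onI) (metis linorder_neqE_nat)
  then have "card S = card ((!) xs ` S)" by (simp add: card_image)
  also have "\<dots> \<le> card A" using assms S(1) by (intro card_mono) (auto dest!: subsetD)
  finally show ?thesis using S(2) by simp
qed

text \<open>By independence the samples may be drawn first. Once they are fixed so are the picks,
  and only the index list is still random.\<close>

lemma run_clique_alg:
  "run (clique_alg n m s q k) P =
    bind_pmf (replicate_pmf s P) (\<lambda>xs.
      map_pmf (\<lambda>js. \<not> conflict_clique m s (answers_of (snd (prefix_plan s q js)) xs))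
        (replicate_pmf k (pmf_of_set {..<n})))"
  unfolding map_pmf_def bind_commute_pmf[of "replicate_pmf s P"]
  by (simp add: run_def clique_alg_def bind_map_pmf prefix_plan_def)

lemma clique_alg_complete:
  assumes "P \<in> supp_at_most n m"
  shows "pmf (run (clique_alg n m s q k) P) True = 1"
proof -
  have fin: "finite (set_pmf P)" and "card (set_pmf P) \<le> m"
    using assms finite_set_pmf_distributions by (auto simp: supp_at_most_def)
  then have "\<not> conflict_clique m s (answers_of J xs)" if "xs \<in> set_pmf (replicate_pmf s P)" for J xs
    using conflict_clique_supp[OF fin, of xs s m J] that
    by (auto simp: set_replicate_pmf lists_eq_set)
  then have "set_pmf (run (clique_alg n m s q k) P) \<subseteq> {True}"
    by (auto simp: run_clique_alg)
  then show ?thesis by (simp add: set_pmf_subset_singleton)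
qed

lemma conflict_prefix_plan:
  assumes "j < i" "i < s" "q i \<le> q j" "r < q i" "xs ! i ! (js ! r) \<noteq> xs ! j ! (js ! r)"
  shows "conflict (answers_of (snd (prefix_plan s q js)) xs) i j"
proof -
  have "(i, js ! r) \<in> snd (prefix_plan s q js)" "(j, js ! r) \<in> snd (prefix_plan s q js)"
    using assms by (auto simp: prefix_plan_def intro!: exI[of _ r])
  then show ?thesis
    using assms(5) unfolding conflict_def answers_of_def
    by (intro exI[of _ "xs ! i ! (js ! r)"] exI[of _ "js ! r"]) auto
qed

text \<open>The two terms bound the two ways to accept: the samples lie in the bad event of the
  supermartingale, or two of \<open>m + 1\<close> picks agree on all common queries.\<close>

lemma clique_alg_accept_prob:
  assumes n: "0 < n" and P: "P \<in> distributions n" and far: "far_from_supp n m \<epsilon> P"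
    and M: "0 < M" and \<epsilon>: "0 < \<epsilon>" "\<epsilon> \<le> 1 / 2"
    and s: "s = num_samples M \<epsilon>" and t: "t = threshold M \<epsilon>"
    and q: "\<And>i. i < s \<Longrightarrow> q i \<le> k" "\<And>i. i < s \<Longrightarrow> c / t i \<le> q i"
      "\<And>i j. j < i \<Longrightarrow> i < s \<Longrightarrow> q i \<le> q j"
  shows "pmf (run (clique_alg n m s q k) P) True
    \<le> 2 ^ m * exp (- ((real M - 1) / 2)) + real (Suc m) ^ 2 * exp (- c)"
proof -
  let ?R = "replicate_pmf s P" and ?D = "replicate_pmf k (pmf_of_set {..<n})"
  let ?B = "{xs. card (picks t (hamming n) xs s) \<le> m \<and>
      real M - 1 \<le> (\<Sum>i<s. pick_prob t (hamming n) P xs i)}"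
  let ?acc = "\<lambda>xs js. \<not> conflict_clique m s (answers_of (snd (prefix_plan s q js)) xs)"
  let ?\<delta> = "real (Suc m) ^ 2 * exp (- c)"
  have good: "measure_pmf.prob ?D {js. ?acc xs js} \<le> ?\<delta>"
    if xs: "xs \<in> set_pmf ?R" "xs \<notin> ?B" for xs
  proof -
    \<comment> \<open>With at most \<open>m\<close> picks, farness would make the pick probabilities
      add up to \<open>M - 1\<close>, putting \<open>xs\<close> into \<open>?B\<close>.\<close>
    have "m < card (picks t (hamming n) xs s)"
      using far_imp_sum_pick_prob[OF P far M \<epsilon> s t xs(1)] xs(2) by fastforce
    \<comment> \<open>Keeping exactly \<open>m + 1\<close> picks limits the union bound to fewer
      than (m + 1)^2 pairs.\<close>
    then obtain S where S: "S \<subseteq> picks t (hamming n) xs s" "card S = Suc m"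
      by (metis Suc_leI obtain_subset_with_card_n)
    then have Ss: "S \<subseteq> {..<s}" using picks_subset[of t "hamming n" xs s] by blast
    have "?acc xs js \<Longrightarrow> \<exists>i\<in>S. \<exists>j\<in>S. j < i \<and> (\<forall>r<q i. xs ! i ! (js ! r) = xs ! j ! (js ! r))" for js
      using S(2) Ss q(3) unfolding conflict_clique_def
      by (meson conflict_prefix_plan lessThan_iff subsetD)
    then have "measure_pmf.prob ?D {js. ?acc xs js} \<le>
        measure_pmf.prob ?D {js. \<exists>i\<in>S. \<exists>j\<in>S. j < i \<and> (\<forall>r<q i. xs ! i ! (js ! r) = xs ! j ! (js ! r))}"
      by (intro measure_pmf.finite_measure_mono) auto
    also have "\<dots> \<le> real (card S) ^ 2 * exp (- c)"
      using S(1) Ss q(1,2) threshold_pos[OF M \<epsilon>(1)] n finite_subset[OF Ss]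
        picks_apart[where t = t and d = "hamming n" and xs = xs and s = s]
      by (intro prob_some_pair_agrees[where t = t]) (auto simp: t subset_iff)
    finally show ?thesis by (simp only: S(2))
  qed
  have "ennreal (pmf (run (clique_alg n m s q k) P) True) =
      (\<integral>\<^sup>+xs. emeasure ?D {js. ?acc xs js} \<partial>?R)"
    unfolding run_clique_alg emeasure_pmf_single[symmetric]
    by (simp add: vimage_def)
  also have "\<dots> \<le> (\<integral>\<^sup>+xs. indicator ?B xs + ennreal ?\<delta> \<partial>?R)"
  proof (intro nn_integral_mono_AE AE_pmfI)
    fix xs assume "xs \<in> set_pmf ?R"
    then show "emeasure ?D {js. ?acc xs js} \<le> indicator ?B xs + ennreal ?\<delta>"
      using good[of xs] measure_pmf.emeasure_le_1[of ?D "{js. ?acc xs js}"]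
      by (cases "xs \<in> ?B") (auto simp: measure_pmf.emeasure_eq_measure intro!: add_increasing2 ennreal_leI)
  qed
  also have "\<dots> = ennreal (measure_pmf.prob ?R ?B + ?\<delta>)"
    by (subst nn_integral_add) (simp_all add: measure_pmf.emeasure_eq_measure ennreal_plus)
  finally have "pmf (run (clique_alg n m s q k) P) True \<le> measure_pmf.prob ?R ?B + ?\<delta>"
    by (subst (asm) ennreal_le_iff) auto
  then show ?thesis
    using prob_few_picks[of s P t "hamming n" m "real M - 1"] by linarith
qed

section \<open>Constants and conclusion\<close>

text \<open>As 2^m <= e^m, the first term is at most exp (1/2 - 2 m) <= 1/8. The second is (m + 1)^2
  / m^6 <= 9/64, by m + 1 <= 3 m / 2.\<close>

lemma accept_prob_numeric:
  assumes "2 \<le> m"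
  shows "2 ^ m * exp (- ((real (6 * m) - 1) / 2)) + real (Suc m) ^ 2 * exp (- (6 * ln (real m))) < 1 / 3"
proof -
  have e2: "2 \<le> exp (1::real)" using exp_ge_add_one_self[of 1] by simp
  have "2 ^ m * exp (- ((real (6 * m) - 1) / 2)) \<le> exp 1 ^ m * exp (- ((real (6 * m) - 1) / 2))"
    using e2 by (intro mult_right_mono power_mono) auto
  also have "\<dots> = exp (1 / 2 - 2 * real m)"
    by (simp add: field_simps flip: exp_of_nat_mult exp_add)
  also have "\<dots> \<le> exp (- 3)" using assms by simp
  also have "\<dots> = 1 / exp 1 ^ 3" by (simp add: exp_minus field_simps flip: exp_of_nat_mult)
  also have "\<dots> \<le> 1 / 2 ^ 3" using e2 by (intro divide_left_mono power_mono) auto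
  finally have 1: "2 ^ m * exp (- ((real (6 * m) - 1) / 2)) \<le> 1 / 8" by simp
  have "exp (- (6 * ln (real m))) = 1 / real m ^ 6"
    using assms exp_of_nat_mult[of 6 "ln (real m)"] by (simp add: exp_minus inverse_eq_divide)
  moreover have "real (Suc m) ^ 2 \<le> (3 / 2 * real m) ^ 2"
    using assms by (intro power_mono) auto
  ultimately have "real (Suc m) ^ 2 * exp (- (6 * ln (real m))) \<le> (3 / 2 * real m) ^ 2 * (1 / real m ^ 6)"
    by (simp add: divide_right_mono)
  also have "\<dots> = 9 / 4 / real m ^ 4" using assms by (simp add: field_simps eval_nat_numeral)
  also have "\<dots> \<le> 9 / 4 / 2 ^ 4" using assms by (intro divide_left_mono power_mono) auto
  finally have "real (Suc m) ^ 2 * exp (- (6 * ln (real m))) \<le> 9 / 64" by simp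
  with 1 show ?thesis by linarith
qed

text \<open>Both ln m and ln (1/\<epsilon>) are at least ln 2 >= 1/2. Hence ln (2/\<epsilon>) <= 2
  ln (1/\<epsilon>), and the summand 1 is at most 4 ln m ln (1/\<epsilon>). The constant is 12 * (12
  + 4) = 192.\<close>

lemma query_bound_numeric:
  assumes m: "2 \<le> m" and \<epsilon>: "0 < \<epsilon>" "\<epsilon> \<le> 1 / 2"
  shows "2 * real (6 * m) / \<epsilon> * (6 * ln (real m) * ln (2 / \<epsilon>) + 1)
    \<le> 192 * (1 / \<epsilon>) * ln (1 / \<epsilon>) * (real m * ln (real m))"
proof -
  define a where "a = ln (real m)"
  define b where "b = ln (1 / \<epsilon>)"
  have half: "1 / 2 \<le> ln (2::real)" using ln2_ge_two_thirds by simp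
  have "ln 2 \<le> a" using m by (simp add: a_def)
  have "ln 2 \<le> b" unfolding b_def using \<epsilon> by (intro ln_mono) (auto simp: field_simps)
  have "ln (2 / \<epsilon>) = ln 2 + b" using \<epsilon>(1) by (simp add: b_def ln_div)
  with \<open>ln 2 \<le> b\<close> have "ln (2 / \<epsilon>) \<le> 2 * b" by simp
  moreover have "1 / 2 * (1 / 2) \<le> a * b"
    using half \<open>ln 2 \<le> a\<close> \<open>ln 2 \<le> b\<close> by (intro mult_mono) auto
  moreover have "0 \<le> a" using m by (simp add: a_def)
  ultimately have "6 * a * ln (2 / \<epsilon>) + 1 \<le> 16 * (a * b)"
    using mult_left_mono[of "ln (2 / \<epsilon>)" "2 * b" a] by (simp add: algebra_simps)
  then have "2 * real (6 * m) / \<epsilon> * (6 * a * ln (2 / \<epsilon>) + 1) \<le> 2 * real (6 * m) / \<epsilon> * (16 * (a * b))"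
    using \<epsilon>(1) by (intro mult_left_mono) auto
  then show ?thesis by (simp add: a_def b_def mult_ac)
qed

text \<open>The only string is \<open>[]\<close>, and \<open>hamming 0\<close> vanishes because
  division by zero yields 0.\<close>

lemma not_far_dim_0:
  assumes "P \<in> distributions 0" "1 \<le> m" "0 < \<epsilon>"
  shows "\<not> far_from_supp 0 m \<epsilon> P"
proof
  assume "far_from_supp 0 m \<epsilon> P"
  then have "\<epsilon> < measure_pmf.expectation P (\<lambda>u. Min (hamming 0 u ` {[]}))"
    using assms(2) by (intro far_imp_expectation_Min) (auto simp: cube_def)
  then show False using assms(3) by (simp add: hamming_def)
qed

theorem theorem6p10:
  "\<exists>C::real. C > 0 \<and>
    (\<forall>m::nat. m \<ge> 2 \<longrightarrow>
      (\<forall>\<epsilon>::real. 0 < \<epsilon> \<and> \<epsilon> \<le> 1 / 2 \<longrightarrow>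
        (\<forall>n::nat. \<exists>A::nonadaptive_alg.
          valid_alg n A \<and>
          one_sided_test n m \<epsilon> A \<and>
          queries_at_most A (C * (1 / \<epsilon>) * ln (1 / \<epsilon>) * (real m * ln (real m))))))"
proof (intro exI[of _ 192] conjI allI impI)
  fix m n :: nat and \<epsilon> :: real
  assume m: "2 \<le> m" and "0 < \<epsilon> \<and> \<epsilon> \<le> 1 / 2"
  then have \<epsilon>: "0 < \<epsilon>" "\<epsilon> \<le> 1 / 2" by auto
  let ?bound = "192 * (1 / \<epsilon>) * ln (1 / \<epsilon>) * (real m * ln (real m))"
  show "\<exists>A. valid_alg n A \<and> one_sided_test n m \<epsilon> A \<and> queries_at_most A ?bound"
  proof (cases "n = 0")
    case True
    \<comment> \<open>There is no index to draw, but nothing is far either, so accepting without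
      queries suffices.\<close>
    let ?A = "Nonadaptive_Alg (return_pmf (0, {})) (\<lambda>_ _. return_pmf True)"
    have "valid_alg n ?A" by (simp add: valid_alg_def)
    moreover have "one_sided_test n m \<epsilon> ?A"
      using not_far_dim_0 m \<epsilon>(1) True by (auto simp: one_sided_test_def run_def bind_return_pmf)
    moreover have "queries_at_most ?A ?bound"
      using m \<epsilon> by (simp add: queries_at_most_def)
    ultimately show ?thesis by blast
  next
    case False
    \<comment> \<open>The factor 6 lets exp (-(M - 1)/2) beat 2^m; in \<open>c\<close> it makes each
      pair fail with probability at most m^(-6), against (m + 1)^2 pairs.\<close>
    define M where "M = 6 * m"
    define s where "s = num_samples M \<epsilon>"
    define t where "t = threshold M \<epsilon>"
    define c where "c = 6 * ln (real m)"
    define q where "q i = nat \<lceil>c / t i\<rceil>" for i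
    \<comment> \<open>As \<open>q\<close> is decreasing, an index list of length \<open>q 0\<close>
      serves every sample.\<close>
    define A where "A = clique_alg n m s q (q 0)"
    have M: "0 < M" using m by (simp add: M_def)
    have c: "0 \<le> c" using m by (simp add: c_def)
    have q_mono: "q i \<le> q j" if "j \<le> i" for i j
      unfolding q_def t_def using that M \<epsilon>(1) c
      by (intro nat_mono ceiling_mono divide_left_mono threshold_mono mult_pos_pos threshold_pos) auto
    have q_ge: "c / t i \<le> q i" for i unfolding q_def by linarith
    have "valid_alg n A"
      unfolding A_def using False q_mono by (intro valid_clique_alg) auto
    moreover have "one_sided_test n m \<epsilon> A"
      unfolding one_sided_test_def
    proof (intro conjI ballI impI)
      fix P assume "P \<in> supp_at_most n m"
      then show "pmf (run A P) True = 1" unfolding A_def by (rule clique_alg_complete)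
    next
      fix P assume P: "P \<in> distributions n" and far: "far_from_supp n m \<epsilon> P"
      have "pmf (run A P) True \<le> 2 ^ m * exp (- ((real M - 1) / 2)) + real (Suc m) ^ 2 * exp (- c)"
        unfolding A_def using False q_mono q_ge
        by (intro clique_alg_accept_prob[OF _ P far M \<epsilon> s_def t_def]) auto
      also have "\<dots> < 1 / 3" unfolding M_def c_def using m by (rule accept_prob_numeric)
      finally show "pmf (run A P) False > 2 / 3" by (simp add: pmf_False_conv_True)
    qed
    moreover have "queries_at_most A ?bound"
    proof -
      have "(\<Sum>i<s. real (q i)) \<le> 2 * real M / \<epsilon> * (c * ln (2 / \<epsilon>) + 1)"
        unfolding s_def q_def t_def using M \<epsilon> c by (rule sum_queries_le)
      also have "\<dots> \<le> ?bound" unfolding M_def c_def using m \<epsilon> by (rule query_bound_numeric)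
      finally show ?thesis
        using queries_clique_alg[of n m s q "q 0"] unfolding A_def queries_at_most_def by fastforce
    qed
    ultimately show ?thesis by blast
  qed
qed simp

end
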